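(* A sequence $\mathcal{Z}$ in $\mathbb{D}$ without limit points in $\mathbb{D}$ is admissible if and only if it has bounded density.
   Context: $\mathbb{D}$ is the open unit disk, $\psi(z,\zeta)=\left|\frac{z-\zeta}{1-\bar\zeta z}\right|$ is the pseudohyperbolic metric on $\mathbb{D}$, $D(z,r)=\{w\in\mathbb{D}:\psi(z,w)<r\}$, and for $S\subset\mathbb{D}$, $(S)_\epsilon$ is the $\epsilon$-neighborhood of $S$ in the metric $\psi$. Sequences may have repeated points, and everything is counted with multiplicity. An interpolation scheme for $\mathcal{Z}$ consists of a sequence of domains $G_k\subset\mathbb{D}$ (not necessarily disjoint) with $\mathcal{Z}\subset\bigcup_kG_k$, together with a partition of $\mathcal{Z}$ into disjoint finite subsequences $\mathcal{Z}_k$ (clusters), with $\mathcal{Z}_k$ contained in $G_k$ and with all repetitions of a repeated point in the same cluster, such that (P1) there is $0<R<1$ such that every $G_k$ has pseudohyperbolic diameter at most $R$, and (P2) there is $\epsilon>0$ with $(\mathcal{Z}_k)_\epsilon\subset G_k$ for every $k$. The scheme is admissible if in addition (P3) there is $\delta>0$ such that for all $j\ne k$ the pseudohyperbolic distance from $\mathcal{Z}_j$ to $\mathcal{Z}_k$ is at least $\delta$, and (P4) there is an upper bound $B$ on the number of points (counting multiplicity) in each $\mathcal{Z}_k$. The sequence $\mathcal{Z}$ is admissible if there exists an admissible interpolation scheme for $\mathcal{Z}$ (so that $\mathcal{Z}=\bigcup_k\mathcal{Z}_k$). $\mathcal{Z}$ has bounded density if there are $M<\infty$ and a fixed radius $0<R<1$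 such that for each $z\in\mathbb{D}$ the disk $D(z,R)$ contains no more than $M$ terms (counting multiplicity) of $\mathcal{Z}$; this does not depend on the choice of $R$. *)

theory Defs
  imports "HOL-Analysis.Analysis"
begin

(* A finite or infinite sequence is a family Z :: nat => complex restricted to an index set
   I :: nat set (I = UNIV for an ordinary sequence).  Subsequences are subsets of I, so that
   repeated points are counted with multiplicity by counting indices. *)

abbreviation unit_disk :: "complex set" where
  "unit_disk \<equiv> ball 0 1"

definition psh :: "complex \<Rightarrow> complex \<Rightarrow> real" where
  "psh z \<zeta> = norm ((z - \<zeta>) / (1 - cnj \<zeta> * z))"

definition psh_disk :: "complex \<Rightarrow> real \<Rightarrow> complex set" where
  "psh_disk z r = {w \<in> unit_disk. psh z w < r}"

definition psh_nbhd :: "complex set \<Rightarrow> real \<Rightarrow> complex set" where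
  "psh_nbhd S \<epsilon> = (\<Union>z\<in>S. psh_disk z \<epsilon>)"

(* psh is bounded by 1 on the unit disk, so the real-valued Sup and Inf below have their usual
   meaning on nonempty subsets of the disk, the only sets they are applied to. *)

definition psh_diameter :: "complex set \<Rightarrow> real" where
  "psh_diameter S = (SUP (z, w) \<in> S \<times> S. psh z w)"

definition psh_setdist :: "complex set \<Rightarrow> complex set \<Rightarrow> real" where
  "psh_setdist S T = (INF (z, w) \<in> S \<times> T. psh z w)"

(* A point attained by infinitely many indices is a limit point of the sequence. *)
definition limit_point_of_seq :: "nat set \<Rightarrow> (nat \<Rightarrow> complex) \<Rightarrow> complex \<Rightarrow> bool" where
  "limit_point_of_seq I Z a \<longleftrightarrow> (\<forall>e>0. infinite {n \<in> I. dist (Z n) a < e})"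

(* C k is the index set of the k-th cluster; the scheme is indexed by k in K, where K may be
   finite or infinite. *)
definition interpolation_scheme ::
  "nat set \<Rightarrow> (nat \<Rightarrow> complex) \<Rightarrow> nat set \<Rightarrow> (nat \<Rightarrow> complex set) \<Rightarrow> (nat \<Rightarrow> nat set) \<Rightarrow> bool" where
  "interpolation_scheme I Z K G C \<longleftrightarrow>
     (\<forall>k\<in>K. open (G k) \<and> connected (G k) \<and> G k \<noteq> {} \<and> G k \<subseteq> unit_disk) \<and>
     Z ` I \<subseteq> (\<Union>k\<in>K. G k) \<and>
     (\<Union>k\<in>K. C k) = I \<and> disjoint_family_on C K \<and>
     (\<forall>k\<in>K. finite (C k) \<and> C k \<noteq> {} \<and> Z ` C k \<subseteq> G k) \<and>
     (\<forall>k\<in>K. \<forall>m\<in>C k. \<forall>n\<in>I. Z m = Z n \<longrightarrow> n \<in> C k) \<and>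
     (\<exists>R. 0 < R \<and> R < 1 \<and> (\<forall>k\<in>K. psh_diameter (G k) \<le> R)) \<and>
     (\<exists>\<epsilon>>0. \<forall>k\<in>K. psh_nbhd (Z ` C k) \<epsilon> \<subseteq> G k)"

definition admissible_scheme ::
  "nat set \<Rightarrow> (nat \<Rightarrow> complex) \<Rightarrow> nat set \<Rightarrow> (nat \<Rightarrow> complex set) \<Rightarrow> (nat \<Rightarrow> nat set) \<Rightarrow> bool" where
  "admissible_scheme I Z K G C \<longleftrightarrow>
     interpolation_scheme I Z K G C \<and>
     (\<exists>\<delta>>0. \<forall>j\<in>K. \<forall>k\<in>K. j \<noteq> k \<longrightarrow> \<delta> \<le> psh_setdist (Z ` C j) (Z ` C k)) \<and>
     (\<exists>B::nat. \<forall>k\<in>K. card (C k) \<le> B)"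

definition admissible :: "nat set \<Rightarrow> (nat \<Rightarrow> complex) \<Rightarrow> bool" where
  "admissible I Z \<longleftrightarrow> (\<exists>K G C. admissible_scheme I Z K G C)"

definition bounded_density :: "nat set \<Rightarrow> (nat \<Rightarrow> complex) \<Rightarrow> bool" where
  "bounded_density I Z \<longleftrightarrow>
     (\<exists>(M::nat) R. 0 < R \<and> R < 1 \<and>
        (\<forall>z\<in>unit_disk. finite {n \<in> I. Z n \<in> psh_disk z R} \<and>
                       card {n \<in> I. Z n \<in> psh_disk z R} \<le> M))"

end

(* Join two terms of the sequence when their pseudohyperbolic distance is less than
   d = R / (4 (M + 1)), and take the connected components of this graph as clusters. Among the
   M + 1 annuli {w. j d <= psh z w < (j + 1) d}, j <= M, around a term z, one contains no term of
   the component of z, and steps shorter than d cannot jump over it. So the component stays within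
   M d of z, has at most M elements, and lies well inside the disk D(z, R/4). Conversely, two terms
   in a disk of radius at most d/2 are closer than d, so for an admissible scheme with separation d
   all terms in such a disk belong to the same cluster. *)
theory Submission
  imports Defs "HOL-Complex_Analysis.Riemann_Mapping"
begin

section \<open>The pseudohyperbolic metric\<close>

lemma one_minus_cnj_mult_nonzero:
  assumes "norm a < 1" "norm b < 1"
  shows "1 - cnj a * b \<noteq> 0"
proof
  assume "1 - cnj a * b = 0"
  then have "norm a * norm b = 1"
    by (metis complex_mod_cnj eq_iff_diff_eq_0 norm_mult norm_one)
  moreover have "norm a * norm b < 1 * 1"
    using assms by (intro mult_strict_mono') auto
  ultimately show False by simp
qed

lemma psh_nonneg: "0 \<le> psh a b"
  by (simp add: psh_def)

lemma psh_refl [simp]: "psh a a = 0"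
  by (simp add: psh_def)

lemma psh_commute: "psh a b = psh b a"
proof -
  have "norm (1 - cnj b * a) = norm (cnj (1 - cnj b * a))"
    by (rule complex_mod_cnj [symmetric])
  also have "\<dots> = norm (1 - cnj a * b)"
    by (simp add: mult.commute)
  finally show ?thesis
    by (simp add: psh_def norm_divide norm_minus_commute)
qed

lemma psh_eq_norm_Moebius: "psh a b = norm (Moebius_function 0 b a)"
  by (simp add: psh_def Moebius_function_def)

text \<open>Subtracting the two images puts the factor \<open>1 - cnj c * c\<close> into the
  numerator and the same factor into the denominator, so it cancels. The other factors left over,
  \<open>1 - cnj c * b\<close> and \<open>1 - c * cnj b\<close>, are conjugate and have equal
  norm.\<close>

lemma psh_Moebius:
  assumes "norm a < 1" "norm b < 1" "norm c < 1"
  shows "psh (Moebius_function 0 c a) (Moebius_function 0 c b) = psh a b"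
proof -
  have na: "1 - cnj c * a \<noteq> 0" and nb: "1 - cnj c * b \<noteq> 0" and nc: "1 - cnj c * c \<noteq> 0"
    and nb': "1 - c * cnj b \<noteq> 0" and nab: "1 - cnj b * a \<noteq> 0"
    using one_minus_cnj_mult_nonzero assms by (auto simp: mult.commute)
  have num: "(a - c) / (1 - cnj c * a) - (b - c) / (1 - cnj c * b)
      = (a - b) * (1 - cnj c * c) / ((1 - cnj c * a) * (1 - cnj c * b))"
    using na nb by (simp add: field_simps)
  have den: "1 - cnj ((b - c) / (1 - cnj c * b)) * ((a - c) / (1 - cnj c * a))
      = (1 - cnj b * a) * (1 - cnj c * c) / ((1 - cnj c * a) * (1 - c * cnj b))"
  proof -
    have "(1 - cnj c * a) * (1 - c * cnj b) - (a - c) * (cnj b - cnj c)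
        = (1 - cnj b * a) * (1 - cnj c * c)"
      by algebra
    then show ?thesis
      using na nb' by (simp add: divide_simps mult.commute)
  qed
  have "norm (1 - c * cnj b) = norm (cnj (1 - c * cnj b))"
    by (rule complex_mod_cnj [symmetric])
  also have "\<dots> = norm (1 - cnj c * b)" by simp
  finally have "norm (1 - c * cnj b) = norm (1 - cnj c * b)" .
  then show ?thesis
    unfolding psh_def Moebius_function_simple num den
    using na nb nc nab by (simp add: norm_divide norm_mult)
qed

text \<open>This is the triangle inequality through the origin. The proof passes through the sharper
  bound \<open>(s + t) / (1 + s * t)\<close>, where \<open>s\<close> and \<open>t\<close> are the
  norms of \<open>a\<close> and \<open>b\<close>.\<close>

lemma psh_le_norm_add:
  assumes "norm a < 1" "norm b < 1"
  shows "psh a b \<le> norm a + norm b"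
proof -
  define s t where "s = norm a" and "t = norm b"
  have st: "0 \<le> s" "0 \<le> t" "s < 1" "t < 1" using assms by (auto simp: s_def t_def)
  define D where "D = norm (1 - cnj b * a)"
  have D0: "D > 0"
    using one_minus_cnj_mult_nonzero[OF assms(2,1)] by (simp add: D_def)
  have "D \<le> norm (1::complex) + norm (cnj b * a)"
    unfolding D_def by (rule norm_triangle_ineq4)
  then have D1: "D \<le> 1 + s * t"
    by (simp add: norm_mult s_def t_def mult.commute)
  have eq: "(norm (a - b))\<^sup>2 = D\<^sup>2 - (1 - s\<^sup>2) * (1 - t\<^sup>2)"
    unfolding D_def s_def t_def cmod_power2 by simp algebra
  have s1: "s\<^sup>2 \<le> 1" and t1: "t\<^sup>2 \<le> 1"
    using st by (auto intro: power_le_one)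
  \<comment> \<open>By \<open>eq\<close>, the squared quotient is 1 minus a nonnegative constant
    over \<open>D\<^sup>2\<close>. It grows with \<open>D\<close>, and at the largest possible value
    \<open>D = 1 + s * t\<close> it equals the square of
    \<open>(s + t) / (1 + s * t)\<close>.\<close>
  have "(norm (a - b))\<^sup>2 * (1 + s * t)\<^sup>2 \<le> (s + t)\<^sup>2 * D\<^sup>2"
  proof -
    have "D\<^sup>2 \<le> (1 + s * t)\<^sup>2" using D0 D1 by (intro power_mono) auto
    then have "D\<^sup>2 * ((1 - s\<^sup>2) * (1 - t\<^sup>2)) \<le> (1 + s * t)\<^sup>2 * ((1 - s\<^sup>2) * (1 - t\<^sup>2))"
      using s1 t1 by (intro mult_right_mono) auto
    moreover have "(1 + s * t)\<^sup>2 - (1 - s\<^sup>2) * (1 - t\<^sup>2) = (s + t)\<^sup>2"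
      by algebra
    ultimately show ?thesis unfolding eq by (simp add: algebra_simps flip: \<open>_ = (s + t)\<^sup>2\<close>)
  qed
  then have "norm (a - b) * (1 + s * t) \<le> (s + t) * D"
    using st D0 by (metis add_nonneg_nonneg less_eq_real_def mult_nonneg_nonneg power2_le_imp_le
        power_mult_distrib)
  moreover have "norm (a - b) \<le> norm (a - b) * (1 + s * t)"
    using st by (simp add: mult_le_cancel_left1)
  ultimately have "norm (a - b) \<le> (s + t) * D" by linarith
  then show ?thesis
    using D0 by (simp add: psh_def norm_divide D_def s_def t_def divide_le_eq)
qed

text \<open>The Moebius map sending \<open>c\<close> to 0 preserves \<open>psh\<close>, which
  reduces the claim to the case where the intermediate point is the origin.\<close>

lemma psh_triangle:
  assumes "norm a < 1" "norm b < 1" "norm c < 1"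
  shows "psh a b \<le> psh a c + psh c b"
proof -
  have "psh a b = psh (Moebius_function 0 c a) (Moebius_function 0 c b)"
    using assms by (simp add: psh_Moebius)
  also have "\<dots> \<le> norm (Moebius_function 0 c a) + norm (Moebius_function 0 c b)"
    using assms by (intro psh_le_norm_add Moebius_function_norm_lt_1)
  also have "\<dots> = psh a c + psh c b"
    using psh_commute [of c b] by (simp add: psh_eq_norm_Moebius)
  finally show ?thesis .
qed

section \<open>Pseudohyperbolic disks: topology, inclusions and diameter\<close>

lemma centre_in_psh_disk: "norm z < 1 \<Longrightarrow> 0 < r \<Longrightarrow> z \<in> psh_disk z r"
  by (simp add: psh_disk_def)

text \<open>The Moebius maps with parameters \<open>z\<close> and \<open>-z\<close> are mutually
  inverse, and \<open>psh z w\<close> is the norm of the image of \<open>w\<close> under the first.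
  Connectedness of the disk follows from that of a Euclidean ball.\<close>

lemma psh_disk_eq_Moebius_image:
  assumes "norm z < 1" "r \<le> 1"
  shows "psh_disk z r = Moebius_function 0 (-z) ` ball 0 r"
proof (intro equalityI subsetI)
  fix w assume w: "w \<in> psh_disk z r"
  then have "w = Moebius_function 0 (-z) (Moebius_function 0 z w)"
    using assms by (simp add: psh_disk_def Moebius_function_compose)
  moreover have "Moebius_function 0 z w \<in> ball 0 r"
    using w psh_commute [of z w] by (simp add: psh_disk_def psh_eq_norm_Moebius)
  ultimately show "w \<in> Moebius_function 0 (-z) ` ball 0 r" by blast
next
  fix w assume "w \<in> Moebius_function 0 (-z) ` ball 0 r"
  then obtain u where u: "norm u < r" "w = Moebius_function 0 (-z) u" by auto
  then have "Moebius_function 0 z w = u"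
    using assms by (simp add: Moebius_function_compose)
  then show "w \<in> psh_disk z r"
    using u assms psh_commute [of z w]
    by (auto simp: psh_disk_def psh_eq_norm_Moebius intro: Moebius_function_norm_lt_1)
qed

lemma connected_psh_disk:
  assumes "norm z < 1" "r \<le> 1"
  shows "connected (psh_disk z r)"
proof -
  have "Moebius_function 0 (-z) holomorphic_on ball 0 1"
    using assms by (intro Moebius_function_holomorphic) auto
  then have "continuous_on (ball 0 r) (Moebius_function 0 (-z))"
    using assms by (meson continuous_on_subset holomorphic_on_imp_continuous_on subset_ball)
  then show ?thesis
    using assms by (simp add: psh_disk_eq_Moebius_image connected_continuous_image)
qed

lemma open_psh_disk:
  assumes "norm z < 1"
  shows "open (psh_disk z r)"
proof -
  have "continuous_on unit_disk (\<lambda>w. psh z w)"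
    unfolding psh_def
    using one_minus_cnj_mult_nonzero assms by (intro continuous_intros) (metis mem_ball_0)
  then have "open (unit_disk \<inter> psh z -` {..<r})"
    by (intro continuous_open_preimage) auto
  also have "unit_disk \<inter> psh z -` {..<r} = psh_disk z r"
    by (auto simp: psh_disk_def)
  finally show ?thesis .
qed

lemma psh_disk_subset_psh_disk:
  assumes "norm z < 1" "norm w < 1" "psh z w + r \<le> s"
  shows "psh_disk w r \<subseteq> psh_disk z s"
proof
  fix u assume u: "u \<in> psh_disk w r"
  then have "psh z u \<le> psh z w + psh w u"
    using assms by (intro psh_triangle) (auto simp: psh_disk_def)
  then show "u \<in> psh_disk z s"
    using u assms by (simp add: psh_disk_def)
qed

lemma psh_less_of_mem_psh_disk:
  assumes "norm z < 1" "u \<in> psh_disk z r" "v \<in> psh_disk z r"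
  shows "psh u v < 2 * r"
  using psh_triangle [of u v z] assms by (simp add: psh_disk_def psh_commute [of u z])

lemma psh_diameter_psh_disk_le:
  assumes "norm z < 1" "0 < r"
  shows "psh_diameter (psh_disk z r) \<le> 2 * r"
proof -
  have "psh_disk z r \<noteq> {}" using centre_in_psh_disk assms by blast
  then show ?thesis
    unfolding psh_diameter_def
    using psh_less_of_mem_psh_disk [OF assms(1)]
    by (intro cSUP_least) (auto intro: less_imp_le)
qed

section \<open>Distances between sets\<close>

lemma psh_setdist_le:
  assumes "a \<in> S" "b \<in> T"
  shows "psh_setdist S T \<le> psh a b"
proof -
  have "bdd_below ((\<lambda>(z, w). psh z w) ` (S \<times> T))"
    by (auto simp: bdd_below_def intro!: exI [of _ 0] psh_nonneg)
  then have "psh_setdist S T \<le> (case (a, b) of (z, w) \<Rightarrow> psh z w)"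
    unfolding psh_setdist_def using assms by (intro cINF_lower) auto
  then show ?thesis by simp
qed

lemma psh_setdist_ge:
  assumes "S \<noteq> {}" "T \<noteq> {}" "\<And>a b. a \<in> S \<Longrightarrow> b \<in> T \<Longrightarrow> d \<le> psh a b"
  shows "d \<le> psh_setdist S T"
  unfolding psh_setdist_def using assms by (intro cINF_greatest) auto

section \<open>Admissible sequences have bounded density\<close>

lemma admissible_imp_bounded_density:
  assumes Z: "Z ` I \<subseteq> unit_disk" and adm: "admissible I Z"
  shows "bounded_density I Z"
proof -
  obtain K G C where sch: "admissible_scheme I Z K G C"
    using adm by (auto simp: admissible_def)
  then obtain d B where d: "d > 0"
      and sep: "\<And>j k. j \<in> K \<Longrightarrow> k \<in> K \<Longrightarrow> j \<noteq> k \<Longrightarrow> d \<le> psh_setdist (Z ` C j) (Z ` C k)"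
      and B: "\<And>k. k \<in> K \<Longrightarrow> card (C k) \<le> B"
    unfolding admissible_scheme_def by blast
  have cover: "(\<Union>k\<in>K. C k) = I" and fin: "\<And>k. k \<in> K \<Longrightarrow> finite (C k)"
    using sch by (auto simp: admissible_scheme_def interpolation_scheme_def)
  \<comment> \<open>Two points of a disk of radius at most \<open>d / 2\<close> are closer than the
    separation \<open>d\<close>; the cap \<open>1 / 2\<close> keeps the radius below 1.\<close>
  define r where "r = min (d / 2) (1 / 2)"
  have r: "0 < r" "r < 1" "2 * r \<le> d" using d by (auto simp: r_def)
  have "finite A \<and> card A \<le> B"
    if z: "z \<in> unit_disk" and A: "A = {n \<in> I. Z n \<in> psh_disk z r}" for z A
  \<comment> \<open>A term in the disk is needed to single out the cluster that holds all the
    others.\<close>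
  proof (cases "A = {}")
    case False
    then obtain m where m: "m \<in> A" by blast
    then obtain k where k: "k \<in> K" "m \<in> C k" using cover A by auto
    have "A \<subseteq> C k"
    proof
      fix n assume n: "n \<in> A"
      then obtain j where j: "j \<in> K" "n \<in> C j" using cover A by auto
      have "psh (Z m) (Z n) < d"
        using psh_less_of_mem_psh_disk [of z "Z m" r "Z n"] m n z r A by auto
      then have "psh_setdist (Z ` C k) (Z ` C j) < d"
        using psh_setdist_le [of "Z m" "Z ` C k" "Z n" "Z ` C j"] k j by force
      then show "n \<in> C k" using sep [of k j] k j by force
    qed
    then show ?thesis
      using B fin k by (meson card_mono finite_subset le_trans)
  qed simp
  then show ?thesis
    unfolding bounded_density_def using r by blast
qed

section \<open>Sequences of bounded density are admissible\<close>

text \<open>The edges join indices rather than points, so repeated terms are separate vertices,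
  adjacent as soon as \<open>d > 0\<close>.\<close>

definition close_pairs :: "nat set \<Rightarrow> (nat \<Rightarrow> complex) \<Rightarrow> real \<Rightarrow> (nat \<times> nat) set" where
  "close_pairs I Z d = {(m, n). m \<in> I \<and> n \<in> I \<and> psh (Z m) (Z n) < d}"

lemma sym_close_pairs: "sym (close_pairs I Z d)"
  by (auto simp: close_pairs_def sym_def psh_commute)

lemma close_component_subset:
  assumes "k \<in> I"
  shows "(close_pairs I Z d)\<^sup>* `` {k} \<subseteq> I"
proof
  fix n assume "n \<in> (close_pairs I Z d)\<^sup>* `` {k}"
  then have "(k, n) \<in> (close_pairs I Z d)\<^sup>*" by simp
  then show "n \<in> I"
    using assms by (induction rule: rtrancl_induct) (auto simp: close_pairs_def)
qed

text \<open>Pigeonhole: at most \<open>M\<close> terms cannot meet all \<open>M + 1\<close> annuli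
  of width \<open>d\<close> around \<open>Z k\<close>, and a path with steps shorter than
  \<open>d\<close> never crosses an empty annulus. The condition on \<open>R\<close> places all
  these annuli in the disk where terms are counted.\<close>

lemma close_component_near:
  assumes Z: "Z ` I \<subseteq> unit_disk" and k: "k \<in> I" and d: "d > 0" "real (Suc M) * d \<le> R"
    and fin: "finite {n \<in> I. Z n \<in> psh_disk (Z k) R}"
    and card: "card {n \<in> I. Z n \<in> psh_disk (Z k) R} \<le> M"
    and kn: "(k, n) \<in> (close_pairs I Z d)\<^sup>*"
  shows "psh (Z k) (Z n) < real M * d"
proof -
  define A where "A = {n \<in> I. Z n \<in> psh_disk (Z k) R}"
  \<comment> \<open>The number of the annulus that contains \<open>Z n\<close>, counted from 0 at
    the centre.\<close>
  define f where "f = (\<lambda>n. nat \<lfloor>psh (Z k) (Z n) / d\<rfloor>)"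
  have ball: "norm (Z n) < 1" if "n \<in> I" for n using Z that by auto
  have f_eq: "f n = j" if "real j * d \<le> psh (Z k) (Z n)" "psh (Z k) (Z n) < real (Suc j) * d" for n j
  proof -
    have "\<lfloor>psh (Z k) (Z n) / d\<rfloor> = int j"
      using that d by (intro floor_unique) (auto simp: field_simps)
    then show ?thesis by (simp add: f_def)
  qed
  have "card (f ` A) \<le> M"
    using card fin card_image_le [of A f] by (simp add: A_def)
  then have "\<not> {..M} \<subseteq> f ` A"
    using fin card_mono [of "f ` A" "{..M}"] by (auto simp: A_def)
  then obtain j where j: "j \<le> M" "j \<notin> f ` A" by auto
  have R: "real (Suc i) * d \<le> R" if "i \<le> M" for i
  proof -
    have "real (Suc i) * d \<le> real (Suc M) * d"
      using that d(1) by (intro mult_right_mono) auto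
    then show ?thesis using d(2) by linarith
  qed
  have in_A: "n \<in> A" if "n \<in> I" "psh (Z k) (Z n) < real (Suc j) * d" for n
    using that R [OF j(1)] ball by (auto simp: A_def psh_disk_def)
  \<comment> \<open>Since annulus \<open>j\<close> is empty, a term inside its outer radius is
    already inside its inner radius.\<close>
  have gap: "psh (Z k) (Z n) < real j * d" if "n \<in> I" "psh (Z k) (Z n) < real (Suc j) * d" for n
    using in_A [OF that] f_eq [of j n] that j(2) by force
  \<comment> \<open>One step of the path from within radius \<open>j * d\<close> stays within
    \<open>(j + 1) * d\<close>, and \<open>gap\<close> restores the smaller bound. In the base case
    \<open>gap\<close> applies to \<open>k\<close> itself, at distance 0.\<close>
  from kn have "n \<in> I \<and> psh (Z k) (Z n) < real j * d"
  proof (induction rule: rtrancl_induct)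
    case base
    then show ?case using k gap [of k] d by simp
  next
    case (step y z)
    then have y: "y \<in> I" and z: "z \<in> I" and yz: "psh (Z y) (Z z) < d"
      by (auto simp: close_pairs_def)
    have "psh (Z k) (Z z) \<le> psh (Z k) (Z y) + psh (Z y) (Z z)"
      using ball k y z by (intro psh_triangle) auto
    then have "psh (Z k) (Z z) < real (Suc j) * d"
      using step.IH yz by (simp add: algebra_simps)
    then show ?case using gap z by blast
  qed
  moreover have "real j * d \<le> real M * d" using j d by simp
  ultimately show ?thesis by linarith
qed

lemma bounded_density_imp_admissible:
  assumes Z: "Z ` I \<subseteq> unit_disk" and bd: "bounded_density I Z"
  shows "admissible I Z"
proof -
  obtain M :: nat and R where R: "0 < R" "R < 1"
    and fin: "\<And>z. z \<in> unit_disk \<Longrightarrow> finite {n \<in> I. Z n \<in> psh_disk z R}"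
    and card: "\<And>z. z \<in> unit_disk \<Longrightarrow> card {n \<in> I. Z n \<in> psh_disk z R} \<le> M"
    using bd unfolding bounded_density_def by blast
  \<comment> \<open>Chosen so that the component radius \<open>M * d\<close> plus a margin
    \<open>d\<close> is exactly \<open>R / 4\<close>, the radius of the domains \<open>G k\<close>.
    The same \<open>d\<close> later serves as neighborhood size and as separation.\<close>
  define d where "d = R / (4 * real (Suc M))"
  have d: "d > 0" "real (Suc M) * d = R / 4"
    using R by (auto simp: d_def field_simps)
  have Md: "real M * d + d = R / 4"
    using d(2) by (simp add: algebra_simps)
  define E where "E = close_pairs I Z d"
  define C where "C = (\<lambda>k. E\<^sup>* `` {k})"
  \<comment> \<open>Each component is represented by its least index, so that distinct elements of
    \<open>K\<close> have distinct clusters.\<close>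
  define K where "K = {k \<in> I. \<forall>n \<in> C k. k \<le> n}"
  define G where "G = (\<lambda>k. psh_disk (Z k) (R / 4))"
  have ball: "norm (Z n) < 1" if "n \<in> I" for n using Z that by auto
  have KI: "k \<in> I" if "k \<in> K" for k using that by (simp add: K_def)
  have self: "k \<in> C k" for k by (simp add: C_def)
  have symE: "sym (E\<^sup>*)" unfolding E_def by (intro sym_rtrancl sym_close_pairs)
  have C_eq: "C m = C k" if "m \<in> C k" for m k
    using that symE unfolding C_def sym_def by (blast intro: rtrancl_trans)
  have C_sub: "C k \<subseteq> I" if "k \<in> I" for k
    using close_component_subset [OF that] by (simp add: C_def E_def)
  have near: "psh (Z k) (Z n) < real M * d" if "k \<in> I" "n \<in> C k" for k n
    using that d(2) R ball
    by (intro close_component_near [OF Z that(1) d(1), where R = R] fin card)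
       (auto simp: C_def E_def)
  have K_unique: "j = k" if "j \<in> K" "k \<in> K" "C j = C k" for j k
    using that self unfolding K_def by (metis (mono_tags, lifting) le_antisym mem_Collect_eq)
  \<comment> \<open>With distance 0 this puts repeated points into one cluster; its contrapositive
    gives the separation of distinct clusters.\<close>
  have edge: "C m = C n" if "m \<in> I" "n \<in> I" "psh (Z m) (Z n) < d" for m n
  proof (rule C_eq)
    show "m \<in> C n"
      using that by (auto simp: C_def E_def close_pairs_def psh_commute intro!: r_into_rtrancl)
  qed
  have rep: "\<exists>k\<in>K. n \<in> C k" if "n \<in> I" for n
  proof
    define k where "k = (LEAST m. m \<in> C n)"
    have k: "k \<in> C n" unfolding k_def using self by (rule LeastI)
    then have "C k = C n" by (rule C_eq)
    then show "n \<in> C k" using self by simp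
    have "\<forall>m \<in> C n. k \<le> m" unfolding k_def by (auto intro: Least_le)
    then show "k \<in> K"
      using k C_sub [OF that] \<open>C k = C n\<close> by (auto simp: K_def)
  qed
  \<comment> \<open>This carries the density bound \<open>M\<close> over to the cluster
    size.\<close>
  have C_in_disk: "C k \<subseteq> {n \<in> I. Z n \<in> psh_disk (Z k) R}" if "k \<in> I" for k
    using near [OF that] C_sub [OF that] ball Md d(1) R by (force simp: psh_disk_def)
  have finC: "finite (C k)" "card (C k) \<le> M" if "k \<in> I" for k
  proof -
    have "Z k \<in> unit_disk" using ball [OF that] by simp
    then show "finite (C k)" "card (C k) \<le> M"
      using C_in_disk [OF that] fin [of "Z k"] card [of "Z k"]
      by (meson finite_subset card_mono le_trans)+
  qed
  have nbhd: "psh_nbhd (Z ` C k) d \<subseteq> G k" if "k \<in> I" for k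
    unfolding psh_nbhd_def G_def
    using near [OF that] C_sub [OF that] ball that Md
    by (intro UN_least psh_disk_subset_psh_disk) force+
  have ZG: "Z ` C k \<subseteq> G k" if "k \<in> I" for k
    using nbhd [OF that] centre_in_psh_disk [OF ball d(1)] C_sub [OF that]
    unfolding psh_nbhd_def by blast
  have sch: "interpolation_scheme I Z K G C"
    unfolding interpolation_scheme_def
  proof (intro conjI ballI impI)
    fix k assume "k \<in> K"
    then have k: "k \<in> I" by (rule KI)
    show "open (G k)" "connected (G k)" "G k \<noteq> {}" "G k \<subseteq> unit_disk"
      using ball [OF k] R centre_in_psh_disk [of "Z k" "R / 4"]
      by (auto simp: G_def open_psh_disk connected_psh_disk) (auto simp: psh_disk_def)
    show "finite (C k)" "C k \<noteq> {}" "Z ` C k \<subseteq> G k"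
      using finC(1) [OF k] self [of k] ZG [OF k] by auto
    fix m n assume m: "m \<in> C k" and n: "n \<in> I" and "Z m = Z n"
    then have "C m = C n" using C_sub [OF k] d(1) by (intro edge) auto
    then show "n \<in> C k" using C_eq [OF m] self by auto
  next
    show "Z ` I \<subseteq> (\<Union>k\<in>K. G k)" using rep ZG [OF KI] by blast
    show "(\<Union>k\<in>K. C k) = I" using rep C_sub [OF KI] by blast
    show "disjoint_family_on C K"
      unfolding disjoint_family_on_def
    proof (intro ballI impI)
      fix j k assume jk: "j \<in> K" "k \<in> K" "j \<noteq> k"
      have "C j = C k" if "n \<in> C j" "n \<in> C k" for n
        using C_eq [OF that(1)] C_eq [OF that(2)] by simp
      then show "C j \<inter> C k = {}" using K_unique [OF jk(1,2)] jk(3) by blast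
    qed
    \<comment> \<open>Twice the radius \<open>R / 4\<close>, hence below 1.\<close>
    have "psh_diameter (G k) \<le> R / 2" if "k \<in> K" for k
      using psh_diameter_psh_disk_le [of "Z k" "R / 4"] ball KI that R by (simp add: G_def)
    then show "\<exists>R. 0 < R \<and> R < 1 \<and> (\<forall>k\<in>K. psh_diameter (G k) \<le> R)"
      using R by (intro exI [of _ "R / 2"]) auto
    show "\<exists>\<epsilon>>0. \<forall>k\<in>K. psh_nbhd (Z ` C k) \<epsilon> \<subseteq> G k"
      using d(1) nbhd [OF KI] by blast
  qed
  have sep: "d \<le> psh_setdist (Z ` C j) (Z ` C k)" if "j \<in> K" "k \<in> K" "j \<noteq> k" for j k
  proof (rule psh_setdist_ge)
    fix a b assume "a \<in> Z ` C j" "b \<in> Z ` C k"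
    then obtain m n where mn: "m \<in> C j" "n \<in> C k" "a = Z m" "b = Z n" by blast
    then have "C m = C j" "C n = C k" using C_eq by blast+
    then have "C m \<noteq> C n" using K_unique [OF that(1,2)] that(3) by auto
    then show "d \<le> psh a b"
      using edge [of m n] mn C_sub [OF KI [OF that(1)]] C_sub [OF KI [OF that(2)]] by force
  next
    show "Z ` C j \<noteq> {}" "Z ` C k \<noteq> {}" using self [of j] self [of k] by auto
  qed
  have "admissible_scheme I Z K G C"
    unfolding admissible_scheme_def using sch sep finC(2) [OF KI] d(1) by blast
  then show ?thesis unfolding admissible_def by blast
qed

theorem theorem4p1:
  fixes I :: "nat set" and Z :: "nat \<Rightarrow> complex"
  assumes "Z ` I \<subseteq> unit_disk"
    and "\<And>a. a \<in> unit_disk \<Longrightarrow> \<not> limit_point_of_seq I Z a"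
  shows "admissible I Z \<longleftrightarrow> bounded_density I Z"
  using assms(1) admissible_imp_bounded_density bounded_density_imp_admissible by blast

end
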